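(* Let $K$ be a positive integer, $\mathcal K=\{1,\dots,K\}$, let $c_1\le c_2\le\dots\le c_K$ be positive integers, let $p_k\in(0,1]$ for $k\in\mathcal K$ and $P^{\mathrm{th}}_{\mathrm{out}}\in(0,1]$ with $\prod_{k\in\mathcal K}p_k\le P^{\mathrm{th}}_{\mathrm{out}}$. Let $f(\mathbf z)=\sum_{k\in\mathcal K}c_kz_k$ and $\mathcal F=\{\mathbf z\in\{0,1\}^K:\ \prod_{k\in\mathcal K}p_k^{z_k}\le P^{\mathrm{th}}_{\mathrm{out}}\}$. Then Algorithm 1 (defined in the context) is guaranteed to find a globally optimal solution, i.e. it returns an element of $\arg\min_{\mathbf z\in\mathcal F}f(\mathbf z)$. Moreover, its overall complexity is $\Theta(KC)=O(K\overline C)=O(K^2c_{\max})$, where $C$ is the integer computed in step (ii) of the algorithm, $\overline C=\sum_{k\in\mathcal K}c_k$ and $c_{\max}=\max_{k\in\mathcal K}c_k=c_K$ (so that $C\le\overline C\le Kc_{\max}$). As a result, Algorithm 1 has pseudo-polynomial time complexity.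
   Context: Complexity is the number of elementary operations (arithmetic operations on real numbers including logarithms, comparisons, assignments, table accesses), each counted at unit cost. Algorithm 1 (dynamic programming). Input: a positive integer $K$, positive integers $c_1\le\dots\le c_K$, $p_1,\dots,p_K\in(0,1]$, and $P^{\mathrm{th}}_{\mathrm{out}}\in(0,1]$ with $\prod_{k}p_k\le P^{\mathrm{th}}_{\mathrm{out}}$. (i) Set $a_k:=-\log(p_k)$ for all $k$ and $b:=-\log(P^{\mathrm{th}}_{\mathrm{out}})$. (ii) Set $A:=0$, $C:=0$, $k:=1$; while $A<b$ do: $A:=A+a_k$, $C:=C+c_k$, $k:=k+1$. (iii) Set $R(0,0):=0$ and $R(0,j):=-\infty$ for $j=1,\dots,C$. For $i=1,\dots,K$ and $j=0,\dots,C$ set $R(i,j):=\max\{R(i-1,j),\,a_i+R(i-1,j-c_i)\}$ if $j\ge c_i$, and $R(i,j):=R(i-1,j)$ otherwise. (iv) Set $j^*:=\min\{j\in\{0,\dots,C\}:R(K,j)\ge b\}$, $q:=R(K,j^* )$, $j:=j^*$. For $i=K,K-1,\dots,1$: if $q=R(i-1,j)$, set $z_i:=0$ and $q:=R(i-1,j)$; otherwise set $z_i:=1$, $q:=R(i-1,j-c_i)$, $j:=j-c_i$. Output: $[z_1,\dots,z_K]$.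
   Formalization: The bound Θ(KC) is stated only for instances with C ≥ 1; when P_out^th = 1 one has C = 0, so KC = 0 while the algorithm still performs a positive number of operations and the literal bound fails. *)

theory Defs
  imports
    "HOL-Analysis.Analysis"
    "HOL-Computational_Algebra.Polynomial"
    "HOL-Library.Extended_Real"
    "HOL-Library.Landau_Symbols"
    "HOL-Library.Log_Nat"
    "HOL-Library.Monad_Syntax"
begin

section \<open>Problem instances\<close>

text \<open>The items are \<open>1, \<dots>, num_items I\<close>; the values of \<open>cost\<close> and \<open>prob\<close> at other indices
  are junk.\<close>

record inst =
  num_items :: nat
  cost :: "nat \<Rightarrow> nat"
  prob :: "nat \<Rightarrow> real"
  threshold :: real

definition instances :: "inst set" where
  "instances = {I.
     num_items I > 0 \<and>
     (\<forall>k\<in>{1..num_items I}. cost I k > 0) \<and>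
     mono_on {1..num_items I} (cost I) \<and>
     (\<forall>k\<in>{1..num_items I}. 0 < prob I k \<and> prob I k \<le> 1) \<and>
     0 < threshold I \<and> threshold I \<le> 1 \<and>
     (\<Prod>k\<in>{1..num_items I}. prob I k) \<le> threshold I}"

definition objective :: "inst \<Rightarrow> (nat \<Rightarrow> nat) \<Rightarrow> nat" where
  "objective I z = (\<Sum>k\<in>{1..num_items I}. cost I k * z k)"

text \<open>Vectors in \<open>{0,1}\<^sup>K\<close> are extensional functions, equal to \<^term>\<open>undefined\<close> outside \<open>{1..K}\<close>.\<close>

definition feasible :: "inst \<Rightarrow> (nat \<Rightarrow> nat) set" where
  "feasible I = {z \<in> {1..num_items I} \<rightarrow>\<^sub>E {0, 1}.
     (\<Prod>k\<in>{1..num_items I}. prob I k ^ z k) \<le> threshold I}"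

definition total_cost :: "inst \<Rightarrow> nat" where
  "total_cost I = (\<Sum>k\<in>{1..num_items I}. cost I k)"

definition max_cost :: "inst \<Rightarrow> nat" where
  "max_cost I = Max (cost I ` {1..num_items I})"

section \<open>Programs with unit operation costs\<close>

text \<open>A computation either diverges (\<^term>\<open>None\<close>) or yields a result together with the number of
  elementary operations performed.  The only cost-generating primitive is \<open>elementary\<close>; binding,
  tupling and branching on an already computed truth value are bookkeeping and free.\<close>

type_synonym 'a timed = "('a \<times> nat) option"

definition return :: "'a \<Rightarrow> 'a timed" where
  "return x = Some (x, 0)"

definition elementary :: "'a \<Rightarrow> 'a timed" where
  "elementary x = Some (x, 1)"

abbreviation (input) arith :: "'a \<Rightarrow> 'a timed" where "arith \<equiv> elementary"
abbreviation (input) compare :: "'a \<Rightarrow> 'a timed" where "compare \<equiv> elementary"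
abbreviation (input) assign :: "'a \<Rightarrow> 'a timed" where "assign \<equiv> elementary"
abbreviation (input) access :: "'a \<Rightarrow> 'a timed" where "access \<equiv> elementary"

definition bind_timed :: "'a timed \<Rightarrow> ('a \<Rightarrow> 'b timed) \<Rightarrow> 'b timed" where
  "bind_timed m f = Option.bind m (\<lambda>(x, t). Option.bind (f x) (\<lambda>(y, u). Some (y, t + u)))"

no_adhoc_overloading Monad_Syntax.bind \<rightleftharpoons> Option.bind
adhoc_overloading Monad_Syntax.bind \<rightleftharpoons> bind_timed

lemma bind_timed_mono [partial_function_mono]:
  assumes "mono_option B" and "\<And>y. mono_option (\<lambda>f. C y f)"
  shows "mono_option (\<lambda>f. bind_timed (B f) (\<lambda>y. C y f))"
  unfolding bind_timed_def case_prod_beta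
  by (intro bind_mono assms option.const_mono)

partial_function (option) while_loop ::
    "('s \<Rightarrow> bool timed) \<Rightarrow> ('s \<Rightarrow> 's timed) \<Rightarrow> 's \<Rightarrow> 's timed" where
  "while_loop test body s = do {
     t \<leftarrow> test s;
     if t then do { s' \<leftarrow> body s; while_loop test body s' } else return s
   }"

text \<open>A counting loop over the given range of counter values, including its overhead: the counter
  is initialised, tested before each iteration and at exit, and updated (one arithmetic operation
  and one assignment) after each iteration.\<close>

fun for_steps :: "nat list \<Rightarrow> (nat \<Rightarrow> 's \<Rightarrow> 's timed) \<Rightarrow> 's \<Rightarrow> 's timed" where
  "for_steps [] body s = do { compare (); return s }"
| "for_steps (i # xs) body s = do {
     compare ();
     s' \<leftarrow> body i s;
     arith ();
     assign ();
     for_steps xs body s'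
   }"

definition for_loop :: "nat list \<Rightarrow> (nat \<Rightarrow> 's \<Rightarrow> 's timed) \<Rightarrow> 's \<Rightarrow> 's timed" where
  "for_loop xs body s = do { assign (); for_steps xs body s }"

section \<open>The dynamic programming algorithm\<close>

text \<open>Tables are functions, and a table write is a function update.  Tables start out
  \<^term>\<open>undefined\<close>, i.e. uninitialised.\<close>

definition step_i :: "inst \<Rightarrow> ((nat \<Rightarrow> real) \<times> real) timed" where
  "step_i I = do {
     a \<leftarrow> for_loop [1..<Suc (num_items I)] (\<lambda>k a. do {
            x \<leftarrow> access (prob I k);
            l \<leftarrow> arith (ln x);
            m \<leftarrow> arith (- l);
            assign (a(k := m))
          }) (\<lambda>_. undefined);
     l \<leftarrow> arith (ln (threshold I));
     m \<leftarrow> arith (- l);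
     b \<leftarrow> assign m;
     return (a, b)
   }"

definition step_ii :: "inst \<Rightarrow> (nat \<Rightarrow> real) \<Rightarrow> real \<Rightarrow> nat timed" where
  "step_ii I a b = do {
     A \<leftarrow> assign (0 :: real);
     C \<leftarrow> assign (0 :: nat);
     k \<leftarrow> assign (1 :: nat);
     (A, C, k) \<leftarrow> while_loop
       (\<lambda>(A, C, k). compare (A < b))
       (\<lambda>(A, C, k). do {
          x \<leftarrow> access (a k);
          x \<leftarrow> arith (A + x);
          A \<leftarrow> assign x;
          y \<leftarrow> access (cost I k);
          y \<leftarrow> arith (C + y);
          C \<leftarrow> assign y;
          k' \<leftarrow> arith (k + 1);
          k \<leftarrow> assign k';
          return (A, C, k)
        })
       (A, C, k);
     return C
   }"

definition store :: "(nat \<Rightarrow> nat \<Rightarrow> ereal) \<Rightarrow> nat \<Rightarrow> nat \<Rightarrow> ereal \<Rightarrow> (nat \<Rightarrow> nat \<Rightarrow> ereal) timed" where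
  "store R i j x = assign (R(i := (R i)(j := x)))"

definition step_iii :: "inst \<Rightarrow> (nat \<Rightarrow> real) \<Rightarrow> nat \<Rightarrow> (nat \<Rightarrow> nat \<Rightarrow> ereal) timed" where
  "step_iii I a C = do {
     R \<leftarrow> store (\<lambda>_ _. undefined) 0 0 0;
     R \<leftarrow> for_loop [1..<Suc C] (\<lambda>j R. store R 0 j (-\<infinity>)) R;
     for_loop [1..<Suc (num_items I)] (\<lambda>i R.
       for_loop [0..<Suc C] (\<lambda>j R. do {
         i' \<leftarrow> arith (i - 1);
         u \<leftarrow> access (R i' j);
         ci \<leftarrow> access (cost I i);
         t \<leftarrow> compare (j \<ge> ci);
         if t then do {
           j' \<leftarrow> arith (j - ci);
           v \<leftarrow> access (R i' j');
           ai \<leftarrow> access (a i);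
           w \<leftarrow> arith (ereal ai + v);
           m \<leftarrow> compare (max u w);
           store R i j m
         } else store R i j u
       }) R) R
   }"

text \<open>The minimum \<open>j*\<close> is found by a linear scan from \<open>0\<close> upwards.  By the choice
  of \<open>C\<close> in \<open>step_ii\<close>, \<open>R(K, C) \<ge> b\<close>, so the scan stays within \<open>{0, \<dots>, C}\<close>.\<close>

definition step_iv ::
    "inst \<Rightarrow> real \<Rightarrow> (nat \<Rightarrow> nat \<Rightarrow> ereal) \<Rightarrow> (nat \<Rightarrow> nat) timed" where
  "step_iv I b R = do {
     j \<leftarrow> assign (0 :: nat);
     jstar \<leftarrow> while_loop
       (\<lambda>j. do { x \<leftarrow> access (R (num_items I) j); compare (\<not> x \<ge> ereal b) })
       (\<lambda>j. do { j' \<leftarrow> arith (j + 1); assign j' })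
       j;
     x \<leftarrow> access (R (num_items I) jstar);
     q \<leftarrow> assign x;
     j \<leftarrow> assign jstar;
     (q, j, z) \<leftarrow> for_loop (rev [1..<Suc (num_items I)]) (\<lambda>i (q, j, z). do {
         i' \<leftarrow> arith (i - 1);
         u \<leftarrow> access (R i' j);
         t \<leftarrow> compare (q = u);
         if t then do {
           z \<leftarrow> assign (z(i := 0));
           q \<leftarrow> assign u;
           return (q, j, z)
         } else do {
           z \<leftarrow> assign (z(i := 1));
           ci \<leftarrow> access (cost I i);
           j' \<leftarrow> arith (j - ci);
           x \<leftarrow> access (R i' j');
           q \<leftarrow> assign x;
           j \<leftarrow> assign j';
           return (q, j, z)
         }
       }) (q, j, (\<lambda>_. undefined));
     return z
   }"

definition algorithm1 :: "inst \<Rightarrow> (nat \<Rightarrow> nat) timed" where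
  "algorithm1 I = do {
     (a, b) \<leftarrow> step_i I;
     C \<leftarrow> step_ii I a b;
     R \<leftarrow> step_iii I a C;
     step_iv I b R
   }"

definition running_time :: "inst \<Rightarrow> nat" where
  "running_time I = snd (the (algorithm1 I))"

definition capacity :: "inst \<Rightarrow> nat" where
  "capacity I = fst (the (do { (a, b) \<leftarrow> step_i I; step_ii I a b }))"

section \<open>Pseudo-polynomial time\<close>

text \<open>Garey and Johnson: the running time is bounded by a polynomial in the two variables
  input length and largest number occurring in the input.\<close>

definition pseudo_polynomial_time ::
    "('i \<Rightarrow> nat) \<Rightarrow> ('i \<Rightarrow> nat) \<Rightarrow> ('i \<Rightarrow> nat) \<Rightarrow> 'i set \<Rightarrow> bool" where
  "pseudo_polynomial_time time len mx S \<longleftrightarrow>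
     (\<exists>P :: nat poly poly. \<forall>I\<in>S. time I \<le> poly (poly P [:mx I:]) (len I))"

text \<open>Integers are written in binary; each of the \<open>K + 1\<close> real inputs occupies one cell.\<close>

definition input_length :: "inst \<Rightarrow> nat" where
  "input_length I = floorlog 2 (num_items I)
     + (\<Sum>k\<in>{1..num_items I}. floorlog 2 (cost I k)) + (num_items I + 1)"

definition max_number :: "inst \<Rightarrow> nat" where
  "max_number I = max (num_items I) (max_cost I)"

end

theory Submission
  imports Defs
begin

text \<open>Taking negative logarithms turns feasibility into the covering constraint
  \<open>\<Sum>k. a k * z k \<ge> b\<close>.  Step (ii) stops at a prefix of the items that is itself feasible, with
  cost \<open>C\<close>, so the optimum is at most \<open>C\<close>.  Since \<open>R i j\<close> is the largest weight of a subset of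
  the first \<open>i\<close> items of cost exactly \<open>j\<close>, the least \<open>j\<close> with \<open>R K j \<ge> b\<close> is the optimal value,
  and backtracking recovers a subset attaining it.  Filling the \<open>K \<times> (C + 1)\<close> table dominates
  the running time.\<close>

section \<open>Total correctness with time bounds\<close>

text \<open>A Hoare triple for total correctness: demanding \<open>Some\<close> excludes divergence.
  Two-sided cost bounds let one derivation serve both halves of the Theta claim.\<close>

definition computes :: "'a timed \<Rightarrow> nat \<Rightarrow> nat \<Rightarrow> ('a \<Rightarrow> bool) \<Rightarrow> bool" where
  "computes m l u Q \<longleftrightarrow> (\<exists>x t. m = Some (x, t) \<and> l \<le> t \<and> t \<le> u \<and> Q x)"

lemma computes_return [simp]: "computes (return x) l u Q \<longleftrightarrow> l = 0 \<and> Q x"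
  by (auto simp: computes_def return_def)

lemma computes_elementary [simp]: "computes (elementary x) l u Q \<longleftrightarrow> l \<le> 1 \<and> 1 \<le> u \<and> Q x"
  by (auto simp: computes_def elementary_def)

text \<open>As a simp rule this executes straight-line code symbolically. Truncated subtraction
  keeps a lower bound 0 at 0, so only the upper budget yields a side condition.\<close>

lemma computes_elementary_bind [simp]:
  "computes (bind_timed (elementary x) f) l u Q \<longleftrightarrow> 1 \<le> u \<and> computes (f x) (l - 1) (u - 1) Q"
  unfolding computes_def bind_timed_def elementary_def
  by (cases "f x") (auto simp: le_diff_conv le_diff_conv2)

lemma computes_bind:
  assumes "computes m l u P" and "\<And>x. P x \<Longrightarrow> computes (f x) l' u' Q"
    and "l'' \<le> l + l'" and "u + u' \<le> u''"
  shows "computes (bind_timed m f) l'' u'' Q"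
proof -
  obtain x t where x: "m = Some (x, t)" "l \<le> t" "t \<le> u" "P x"
    using assms(1) by (auto simp: computes_def)
  obtain y t' where y: "f x = Some (y, t')" "l' \<le> t'" "t' \<le> u'" "Q y"
    using assms(2)[OF x(4)] by (auto simp: computes_def)
  show ?thesis
    using x y assms(3,4) by (auto simp: computes_def bind_timed_def)
qed

lemma computes_weaken:
  assumes "computes m l u P" "l' \<le> l" "u \<le> u'" "\<And>x. P x \<Longrightarrow> Q x"
  shows "computes m l' u' Q"
  using assms by (force simp: computes_def)

text \<open>\<open>J\<close> is indexed by the number of finished iterations, not by the counter, so
  one rule covers ascending and descending loops. Each iteration adds 3 for test, increment and
  assignment; the leading 1 is the exit test.\<close>

lemma computes_for_steps:
  assumes "\<And>k s. k < length xs \<Longrightarrow> J k s \<Longrightarrow> computes (body (xs ! k) s) l u (J (Suc k))"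
    and "J 0 s"
  shows "computes (for_steps xs body s) (1 + length xs * (l + 3)) (1 + length xs * (u + 3))
    (J (length xs))"
  using assms
proof (induction xs arbitrary: J s)
  case Nil
  then show ?case by simp
next
  case (Cons i xs)
  have hd: "computes (body i s) l u (J (Suc 0))"
    using Cons.prems(1)[of 0] Cons.prems(2) by simp
  have tl: "computes (for_steps xs body s') (1 + length xs * (l + 3)) (1 + length xs * (u + 3))
      (J (Suc (length xs)))" if "J (Suc 0) s'" for s'
    using Cons.IH[of "\<lambda>k. J (Suc k)" s'] Cons.prems(1)[of "Suc k" for k] that by simp
  show ?case
    by (simp, rule computes_bind[OF hd, where l' = "3 + length xs * (l + 3)"
          and u' = "3 + length xs * (u + 3)"]) (use tl in \<open>auto simp: numeral_3_eq_3\<close>)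
qed

lemma computes_for_loop:
  assumes "\<And>k s. k < length xs \<Longrightarrow> J k s \<Longrightarrow> computes (body (xs ! k) s) l u (J (Suc k))"
    and "J 0 s"
    and "l' \<le> 2 + length xs * (l + 3)" and "2 + length xs * (u + 3) \<le> u'"
    and "\<And>s. J (length xs) s \<Longrightarrow> Q s"
  shows "computes (for_loop xs body s) l' u' Q"
proof -
  have "computes (for_loop xs body s) (2 + length xs * (l + 3)) (2 + length xs * (u + 3))
      (J (length xs))"
    using computes_for_steps[of xs J body l u s] assms(1,2) by (simp add: for_loop_def)
  then show ?thesis using assms(3-5) by (rule computes_weaken)
qed

text \<open>Termination is enforced by the iteration count \<open>k\<close> in the invariant, bounded by \<open>N\<close>.\<close>

lemma computes_while_loop:
  assumes step: "\<And>k s. J k s \<Longrightarrow> computes (test s) 0 v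
      (\<lambda>t. if t then computes (body s) 0 w (J (Suc k)) else Q s)"
    and bound: "\<And>k s. J k s \<Longrightarrow> k \<le> N"
    and init: "J 0 s"
    and u: "N * (v + w) + v \<le> u"
  shows "computes (while_loop test body s) 0 u Q"
proof -
  have "computes (while_loop test body s) 0 (n * (v + w) + v) Q" if "J k s" "N - k = n" for n k s
    using that
  proof (induction n arbitrary: k s)
    case 0
    \<comment> \<open>No iterations are left, so by \<open>bound\<close> the invariant cannot hold
      one step later. The body therefore has no valid triple, and the test must answer
      false.\<close>
    have "\<not> J (Suc k) s'" for s'
      using bound[of "Suc k" s'] 0 by auto
    then have "\<not> computes (body s) 0 w (J (Suc k))"
      by (auto simp: computes_def)
    then have "computes (test s) 0 v (\<lambda>t. \<not> t \<and> Q s)"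
      using step[OF 0(1)] by (elim computes_weaken) (auto split: if_splits)
    then show ?case
      by (subst while_loop.simps, elim computes_bind[where l' = 0 and u' = 0]) auto
  next
    case (Suc n)
    have then_branch: "computes (bind_timed (body s) (while_loop test body)) 0 (w + (n * (v + w) + v)) Q"
      if "computes (body s) 0 w (J (Suc k))"
      using that by (rule computes_bind[where l' = 0 and u' = "n * (v + w) + v"]) (use Suc in auto)
    show ?case
      by (subst while_loop.simps, rule computes_bind[OF step[OF Suc.prems(1)], where l' = 0
            and u' = "w + (n * (v + w) + v)"]) (use then_branch in \<open>auto split: if_splits\<close>)
  qed
  from this[OF init refl] show ?thesis
    by (rule computes_weaken) (use u in auto)
qed

section \<open>The knapsack recursion\<close>

fun knapsack :: "(nat \<Rightarrow> real) \<Rightarrow> (nat \<Rightarrow> nat) \<Rightarrow> nat \<Rightarrow> nat \<Rightarrow> ereal" where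
  "knapsack a c 0 j = (if j = 0 then 0 else -\<infinity>)"
| "knapsack a c (Suc i) j =
    (if c (Suc i) \<le> j
     then max (knapsack a c i j) (ereal (a (Suc i)) + knapsack a c i (j - c (Suc i)))
     else knapsack a c i j)"

text \<open>The upper-bound half of the meaning of the table: no 0/1 vector beats the entry at its
  cost. The attainment used for optimality comes from backtracking in
  \<open>computes_step_iv\<close>.\<close>

lemma knapsack_ge:
  fixes z :: "nat \<Rightarrow> nat"
  assumes "\<And>k. k \<in> {1..i} \<Longrightarrow> z k = 0 \<or> z k = 1"
  shows "ereal (\<Sum>k\<in>{1..i}. a k * real (z k)) \<le> knapsack a c i (\<Sum>k\<in>{1..i}. c k * z k)"
  using assms
proof (induction i)
  case 0
  then show ?case by simp
next
  case (Suc i)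
  have IH: "ereal (\<Sum>k\<in>{1..i}. a k * real (z k)) \<le> knapsack a c i (\<Sum>k\<in>{1..i}. c k * z k)"
    using Suc by auto
  consider "z (Suc i) = 0" | "z (Suc i) = 1"
    using Suc.prems[of "Suc i"] by auto
  then show ?case
  proof cases
    case 1
    then show ?thesis using IH by (simp add: le_max_iff_disj)
  next
    case 2
    have "ereal (a (Suc i)) + ereal (\<Sum>k\<in>{1..i}. a k * real (z k))
        \<le> ereal (a (Suc i)) + knapsack a c i (\<Sum>k\<in>{1..i}. c k * z k)"
      by (intro add_left_mono IH)
    then show ?thesis using 2 by (simp add: le_max_iff_disj add.commute)
  qed
qed

section \<open>The four steps\<close>

definition weight :: "inst \<Rightarrow> nat \<Rightarrow> real" where
  "weight I k = - ln (prob I k)"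

definition demand :: "inst \<Rightarrow> real" where
  "demand I = - ln (threshold I)"

lemma computes_step_i:
  "computes (step_i I) 0 (5 + num_items I * 7)
    (\<lambda>(a, b). (\<forall>k\<in>{1..num_items I}. a k = weight I k) \<and> b = demand I)"
  unfolding step_i_def
  apply (rule computes_bind[where l = 0 and u = "2 + num_items I * 7"
        and P = "\<lambda>a. \<forall>k\<in>{1..num_items I}. a k = weight I k" and l' = 0 and u' = 3])
     apply (rule computes_for_loop[where J = "\<lambda>n a. \<forall>k\<in>{1..n}. a k = weight I k"
          and l = 0 and u = 4])
         apply (auto simp: weight_def demand_def nth_append)
  done

lemma computes_step_ii:
  assumes a: "\<And>k. k \<in> {1..K} \<Longrightarrow> a k = w k" and K: "K = num_items I"
    and b: "b \<le> (\<Sum>k\<in>{1..K}. w k)"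
  shows "computes (step_ii I a b) 0 (4 + K * 9)
    (\<lambda>C. \<exists>n\<le>K. C = (\<Sum>k\<in>{1..n}. cost I k) \<and> b \<le> (\<Sum>k\<in>{1..n}. w k))"
  unfolding step_ii_def
  apply simp
  apply (rule computes_bind[where l = 0 and u = "1 + K * 9" and l' = 0 and u' = 0 and
     P = "\<lambda>(A, C, k). \<exists>n\<le>K. C = (\<Sum>k\<in>{1..n}. cost I k) \<and> b \<le> (\<Sum>k\<in>{1..n}. w k)"])
     apply (rule computes_while_loop[where v = 1 and w = 8 and N = K and
        J = "\<lambda>n (A, C, k). n \<le> K \<and> k = Suc n \<and> A = (\<Sum>k\<in>{1..n}. w k) \<and> C = (\<Sum>k\<in>{1..n}. cost I k)"])
  \<comment> \<open>After \<open>K\<close> iterations \<open>A\<close> is the full sum, so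
    hypothesis \<open>b\<close> makes the test fail; before that, the entry read,
    \<open>a (Suc k)\<close>, lies within the range where \<open>a\<close> is known.\<close>
  subgoal for k s
    using b a[of "Suc k"]
    by (cases "k = K") (auto simp: not_less)
       apply auto
  done

text \<open>The lower bound \<open>K * C\<close> comes from loop overhead alone: each inner
  iteration costs at least 3 whatever its body does. In the upper bound, 13 is that overhead plus at
  most 10 operations per cell.\<close>

lemma computes_step_iii:
  assumes a: "\<And>k. k \<in> {1..K} \<Longrightarrow> a k = w k" and K: "K = num_items I"
  shows "computes (step_iii I a C) (K * C) (5 + C * 4 + K * (5 + Suc C * 13))
    (\<lambda>R. \<forall>i\<le>K. \<forall>j\<le>C. R i j = knapsack w (cost I) i j)"
proof -
  let ?T = "knapsack w (cost I)"
  define cell where "cell i j R = do {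
         i' \<leftarrow> arith (i - 1);
         u \<leftarrow> access (R i' j);
         ci \<leftarrow> access (cost I i);
         t \<leftarrow> compare (j \<ge> ci);
         if t then do {
           j' \<leftarrow> arith (j - ci);
           v \<leftarrow> access (R i' j');
           ai \<leftarrow> access (a i);
           w \<leftarrow> arith (ereal ai + v);
           m \<leftarrow> compare (max u w);
           store R i j m
         } else store R i j u
       }" for i j and R :: "nat \<Rightarrow> nat \<Rightarrow> ereal"
  \<comment> \<open>Rows up to \<open>k\<close> are complete and row \<open>Suc k\<close> is filled
    left of \<open>j\<close>. The cell reads only row \<open>k\<close> and writes only at
    \<open>(Suc k, j)\<close>, so both facts persist.\<close>
  have cell: "computes (cell (Suc k) j R) 0 10
      (\<lambda>R'. (\<forall>i\<le>k. \<forall>j\<le>C. R' i j = ?T i j) \<and> (\<forall>j'<Suc j. R' (Suc k) j' = ?T (Suc k) j'))"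
    if "k < K" "j \<le> C" "\<forall>i\<le>k. \<forall>j\<le>C. R i j = ?T i j" "\<forall>j'<j. R (Suc k) j' = ?T (Suc k) j'" for k j R
    using that a[of "Suc k"] by (auto simp: cell_def store_def less_Suc_eq)
  have row: "computes (for_loop [0..<Suc C] (cell (Suc k)) R) C (2 + Suc C * 13)
      (\<lambda>R. \<forall>i\<le>Suc k. \<forall>j\<le>C. R i j = ?T i j)"
    if "k < K" "\<forall>i\<le>k. \<forall>j\<le>C. R i j = ?T i j" for k R
    apply (rule computes_for_loop[where l = 0 and u = 10 and J = "\<lambda>j R.
      (\<forall>i\<le>k. \<forall>j\<le>C. R i j = ?T i j) \<and> (\<forall>j'<j. R (Suc k) j' = ?T (Suc k) j')"])
    subgoal for j R
      using cell[of k j R] that(1) by (simp del: upt_Suc knapsack.simps)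
    using that(2) by (auto simp: le_Suc_eq simp del: knapsack.simps)
  have table: "computes (for_loop [1..<Suc K] (\<lambda>i. for_loop [0..<Suc C] (cell i)) R)
      (K * C) (2 + K * (5 + Suc C * 13)) (\<lambda>R. \<forall>i\<le>K. \<forall>j\<le>C. R i j = ?T i j)"
    if "\<forall>j\<le>C. R 0 j = ?T 0 j" for R
    apply (rule computes_for_loop[where l = C and u = "2 + Suc C * 13" and J = "\<lambda>k R.
      \<forall>i\<le>k. \<forall>j\<le>C. R i j = ?T i j"])
    subgoal for k R
      using row[of k R] by (simp del: upt_Suc knapsack.simps)
    using that by (auto simp: algebra_simps simp del: upt_Suc knapsack.simps)
  \<comment> \<open>Column 0 is stored before the loop; hence after \<open>k\<close> iterations
    columns 0 to \<open>k\<close> are correct.\<close>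
  have init: "computes (for_loop [1..<Suc C] (\<lambda>j R. store R 0 j (- \<infinity>)) R) 0 (2 + C * 4)
      (\<lambda>R. \<forall>j\<le>C. R 0 j = ?T 0 j)" if "R 0 0 = 0" for R
    apply (rule computes_for_loop[where l = 0 and u = 1 and J = "\<lambda>k R. \<forall>j\<le>k. R 0 j = ?T 0 j"])
    using that by (auto simp: store_def le_Suc_eq nth_append)
  show ?thesis
    unfolding step_iii_def K[symmetric] cell_def[symmetric]
    apply (subst store_def, subst computes_elementary_bind)
    apply (rule conjI)
     apply simp
    apply (rule computes_bind[OF init table])
       apply simp_all
    done
qed

lemma computes_step_iv:
  assumes K: "K = num_items I"
    and R: "\<And>i j. i \<le> K \<Longrightarrow> j \<le> C \<Longrightarrow> R i j = knapsack w (cost I) i j"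
    and C: "ereal b \<le> knapsack w (cost I) K C"
  shows "computes (step_iv I b R) 0 (8 + C * 4 + K * 13)
    (\<lambda>z. z \<in> {1..K} \<rightarrow>\<^sub>E {0, 1} \<and> b \<le> (\<Sum>k\<in>{1..K}. w k * real (z k)) \<and>
       (\<Sum>k\<in>{1..K}. cost I k * z k) \<le> C \<and>
       (\<forall>j<\<Sum>k\<in>{1..K}. cost I k * z k. knapsack w (cost I) K j < ereal b))"
proof -
  let ?T = "knapsack w (cost I)"
  define body where "body i = (\<lambda>(q :: ereal, j, z :: nat \<Rightarrow> nat). do {
         i' \<leftarrow> arith (i - 1);
         u \<leftarrow> access (R i' j);
         t \<leftarrow> compare (q = u);
         if t then do {
           z \<leftarrow> assign (z(i := 0));
           q \<leftarrow> assign u;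
           return (q, j, z)
         } else do {
           z \<leftarrow> assign (z(i := 1));
           ci \<leftarrow> access (cost I i);
           j' \<leftarrow> arith (j - ci);
           x \<leftarrow> access (R i' j');
           q \<leftarrow> assign x;
           j \<leftarrow> assign j';
           return (q, j, z)
         }
       })" for i
  have scan: "computes (while_loop
       (\<lambda>j. do { x \<leftarrow> access (R K j); compare (\<not> x \<ge> ereal b) })
       (\<lambda>j. do { j' \<leftarrow> arith (j + 1); assign j' }) 0) 0 (2 + C * 4)
       (\<lambda>j. j \<le> C \<and> ereal b \<le> ?T K j \<and> (\<forall>j'<j. ?T K j' < ereal b))"
    apply (rule computes_while_loop[where v = 2 and w = 2 and N = C and
        J = "\<lambda>k j. k = j \<and> j \<le> C \<and> (\<forall>j'<j. ?T K j' < ereal b)"])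
    \<comment> \<open>By hypothesis \<open>C\<close> the entry in column \<open>C\<close> meets the
      demand, so the scan never steps past it.\<close>
    subgoal for k j
      using C R[of K j] by (cases "j = C") (auto simp: not_le less_Suc_eq)
    by auto
  text \<open>\<open>J k\<close> holds when \<open>k\<close> items remain to be decided.\<close>
  define J where "J j0 k = (\<lambda>(q, j, z). q = ?T k j \<and> z \<in> {Suc k..K} \<rightarrow>\<^sub>E {0, 1} \<and>
      ereal b \<le> q + ereal (\<Sum>i\<in>{Suc k..K}. w i * real (z i)) \<and>
      j + (\<Sum>i\<in>{Suc k..K}. cost I i * z i) = j0)" for j0 k
  have body: "computes (body (Suc k) s) 0 9 (J j0 k)"
    if k: "Suc k \<le> K" and j0: "j0 \<le> C" and s: "J j0 (Suc k) s" for j0 k s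
  proof -
    obtain q j z where s_eq: "s = (q, j, z)" by (cases s) auto
    have J: "q = ?T (Suc k) j" "z \<in> {Suc (Suc k)..K} \<rightarrow>\<^sub>E {0, 1}"
      "ereal b \<le> q + ereal (\<Sum>i\<in>{Suc (Suc k)..K}. w i * real (z i))"
      "j + (\<Sum>i\<in>{Suc (Suc k)..K}. cost I i * z i) = j0"
      using s by (auto simp: J_def s_eq)
    have jC: "j \<le> C" using J(4) j0 by simp
    have ivl: "{Suc k..K} = insert (Suc k) {Suc (Suc k)..K}" using k by auto
    have upd: "z(Suc k := v) \<in> {Suc k..K} \<rightarrow>\<^sub>E {0, 1}" if "v \<in> {0, 1}" for v
      unfolding ivl using J(2) that by (intro PiE_fun_upd) auto
    have w_sum: "(\<Sum>i\<in>{Suc k..K}. w i * real ((z(Suc k := v)) i)) =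
        w (Suc k) * real v + (\<Sum>i\<in>{Suc (Suc k)..K}. w i * real (z i))" for v
      by (simp add: ivl)
    have c_sum: "(\<Sum>i\<in>{Suc k..K}. cost I i * (z(Suc k := v)) i) =
        cost I (Suc k) * v + (\<Sum>i\<in>{Suc (Suc k)..K}. cost I i * z i)" for v
      by (simp add: ivl)
    show ?thesis
    proof (cases "q = ?T k j")
      case True
      then have "J j0 k (q, j, z(Suc k := 0))"
        unfolding J_def prod.case w_sum c_sum using J(3,4) upd[of 0] by simp
      then show ?thesis
        using True R[of k j] k jC by (simp add: body_def s_eq)
    next
      case False
      \<comment> \<open>\<open>q\<close> is the entry of row \<open>Suc k\<close> but differs from
        the one above it, so the maximum was attained by taking item \<open>Suc k\<close>, which
        must fit into \<open>j\<close>.\<close>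
      then have c: "cost I (Suc k) \<le> j" and q: "q = ereal (w (Suc k)) + ?T k (j - cost I (Suc k))"
        using J(1) by (auto simp: max_def split: if_splits)
      have "J j0 k (?T k (j - cost I (Suc k)), j - cost I (Suc k), z(Suc k := 1))"
        unfolding J_def prod.case w_sum c_sum using J(3,4) upd[of 1] c
        \<comment> \<open>Splitting the \<open>ereal\<close> of a sum lets the weight of item
          \<open>Suc k\<close> move from \<open>q\<close> to the weight already collected.\<close>
        by (simp add: q ac_simps flip: plus_ereal.simps(1))
      then show ?thesis
        using False R[of k j] R[of k "j - cost I (Suc k)"] k jC by (simp add: body_def s_eq)
    qed
  qed
  have backtrack: "computes (for_loop (rev [1..<Suc K]) body (?T K j0, j0, \<lambda>_. undefined)) 0
      (2 + K * 12) (J j0 0)" if "j0 \<le> C" "ereal b \<le> ?T K j0" for j0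
    \<comment> \<open>Position \<open>k\<close> of the reversed range is item \<open>K - k\<close>,
      that is \<open>Suc (K - Suc k)\<close>, as \<open>body\<close> expects. Initially the index
      set is empty and the undefined vector is its only extensional function.\<close>
    apply (rule computes_for_loop[where l = 0 and u = 9 and J = "\<lambda>n. J j0 (K - n)"])
    subgoal for k s
      using body[of "K - Suc k" j0 s] that(1)
      by (simp add: rev_nth Suc_diff_Suc nth_append del: upt_Suc)
    using that by (auto simp: J_def)
  \<comment> \<open>In row 0 a nonzero \<open>j\<close> would give \<open>q\<close> the value
    \<open>-\<infinity>\<close>, contradicting the bound by \<open>b\<close>. So
    \<open>j = 0\<close>, and the whole cost \<open>j0\<close> is spent on chosen items.\<close>
  have post: "z \<in> {1..K} \<rightarrow>\<^sub>E {0, 1} \<and> b \<le> (\<Sum>k\<in>{1..K}. w k * real (z k)) \<and>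
       (\<Sum>k\<in>{1..K}. cost I k * z k) = j0" if "J j0 0 (q, j, z)" for j0 q j z
    using that by (auto simp: J_def split: if_splits)
  have tail: "computes (do {
        (q, j, z) \<leftarrow> for_loop (rev [1..<Suc K]) body (R K j0, j0, \<lambda>_. undefined);
        return z
      }) 0 (2 + K * 12) (\<lambda>z. z \<in> {1..K} \<rightarrow>\<^sub>E {0, 1} \<and> b \<le> (\<Sum>k\<in>{1..K}. w k * real (z k)) \<and>
       (\<Sum>k\<in>{1..K}. cost I k * z k) = j0)"
    if j0: "j0 \<le> C" "ereal b \<le> ?T K j0" for j0
    unfolding R[OF order_refl j0(1)]
    by (rule computes_bind[OF backtrack[OF j0], where l' = 0 and u' = 0]) (use post in auto)
  show ?thesis
    unfolding step_iv_def K[symmetric] body_def[symmetric]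
    apply (subst computes_elementary_bind, rule conjI, simp)
    apply (rule computes_bind[OF scan, where l' = 0 and u' = "5 + K * 12"])
    subgoal for j0
      by (intro conjI computes_elementary_bind[THEN iffD2] computes_weaken[OF tail]) auto
    by auto
qed

section \<open>Correctness and running time\<close>

text \<open>Both the product and the threshold are strictly positive, so \<open>ln\<close> preserves
  and reflects the inequality between them.\<close>

lemma feasible_iff:
  assumes "I \<in> instances"
  shows "z \<in> feasible I \<longleftrightarrow> z \<in> {1..num_items I} \<rightarrow>\<^sub>E {0, 1} \<and>
    demand I \<le> (\<Sum>k\<in>{1..num_items I}. weight I k * real (z k))"
proof -
  have p: "\<And>k. k \<in> {1..num_items I} \<Longrightarrow> 0 < prob I k" and t: "0 < threshold I"
    using assms by (auto simp: instances_def)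
  have pos: "0 < (\<Prod>k\<in>{1..num_items I}. prob I k ^ z k)"
    using p by (intro prod_pos) auto
  have "ln (\<Prod>k\<in>{1..num_items I}. prob I k ^ z k) =
      (\<Sum>k\<in>{1..num_items I}. ln (prob I k ^ z k))"
    using p by (intro ln_prod) force+
  also have "\<dots> = - (\<Sum>k\<in>{1..num_items I}. weight I k * real (z k))"
    unfolding sum_negf[symmetric]
    using p by (intro sum.cong) (auto simp: ln_realpow weight_def)
  finally show ?thesis
    using ln_le_cancel_iff[OF pos t] by (auto simp: feasible_def demand_def)
qed

text \<open>The instance condition says that selecting every item is feasible. This is what makes
  the loop of step (ii) stop within the \<open>K\<close> items.\<close>

lemma demand_le:
  assumes "I \<in> instances"
  shows "demand I \<le> (\<Sum>k\<in>{1..num_items I}. weight I k)"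
proof -
  have "restrict (\<lambda>_. 1) {1..num_items I} \<in> feasible I"
    using assms by (auto simp: feasible_def instances_def)
  then show ?thesis by (simp add: feasible_iff[OF assms])
qed

text \<open>By \<open>knapsack_ge\<close>, a cheaper feasible vector would push the table entry at
  its own cost up to the demand, contradicting \<open>least\<close>.\<close>

lemma is_arg_min_objective:
  assumes I: "I \<in> instances"
    and z: "z \<in> {1..num_items I} \<rightarrow>\<^sub>E {0, 1}"
      "demand I \<le> (\<Sum>k\<in>{1..num_items I}. weight I k * real (z k))"
    and least: "\<And>j. j < objective I z \<Longrightarrow>
      knapsack (weight I) (cost I) (num_items I) j < ereal (demand I)"
  shows "is_arg_min (objective I) (\<lambda>z. z \<in> feasible I) z"
proof -
  have "\<not> objective I y < objective I z" if "y \<in> feasible I" for y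
  proof
    assume "objective I y < objective I z"
    from least[OF this] have less: "knapsack (weight I) (cost I) (num_items I)
        (\<Sum>k\<in>{1..num_items I}. cost I k * y k) < ereal (demand I)"
      by (simp add: objective_def)
    have y: "y \<in> {1..num_items I} \<rightarrow>\<^sub>E {0, 1}"
      "demand I \<le> (\<Sum>k\<in>{1..num_items I}. weight I k * real (y k))"
      using that I by (auto simp: feasible_iff)
    have "ereal (demand I) \<le> ereal (\<Sum>k\<in>{1..num_items I}. weight I k * real (y k))"
      using y by simp
    also have "\<dots> \<le> knapsack (weight I) (cost I) (num_items I)
        (\<Sum>k\<in>{1..num_items I}. cost I k * y k)"
      using y by (intro knapsack_ge) (auto dest: PiE_mem)
    finally have "ereal (demand I) \<le> knapsack (weight I) (cost I) (num_items I)
        (\<Sum>k\<in>{1..num_items I}. cost I k * y k)" .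
    with less show False by simp
  qed
  then show ?thesis using z I by (auto simp: is_arg_min_def feasible_iff)
qed

text \<open>The upper bound uses \<open>capacity I + 1\<close> because a threshold of 1 gives demand
  and capacity 0, while the algorithm still loops over all items.\<close>

lemma algorithm1_spec:
  assumes I: "I \<in> instances"
  shows "\<exists>z. algorithm1 I = Some (z, running_time I) \<and>
      is_arg_min (objective I) (\<lambda>z. z \<in> feasible I) z"
    and "capacity I \<le> total_cost I"
    and "num_items I * capacity I \<le> running_time I"
    and "running_time I \<le> 100 * num_items I * (capacity I + 1)"
proof -
  let ?K = "num_items I"
  obtain a b t1 where i: "step_i I = Some ((a, b), t1)" "t1 \<le> 5 + ?K * 7"
      "\<And>k. k \<in> {1..?K} \<Longrightarrow> a k = weight I k" "b = demand I"
    using computes_step_i[of I] unfolding computes_def by auto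
  obtain C t2 n where ii: "step_ii I a b = Some (C, t2)" "t2 \<le> 4 + ?K * 9" "n \<le> ?K"
      "C = (\<Sum>k\<in>{1..n}. cost I k)" "demand I \<le> (\<Sum>k\<in>{1..n}. weight I k)"
    using computes_step_ii[where a = a and w = "weight I" and b = b and I = I, OF i(3) refl] demand_le[OF I] i(4)
    unfolding computes_def by auto
  obtain R t3 where iii: "step_iii I a C = Some (R, t3)" "?K * C \<le> t3"
      "t3 \<le> 5 + C * 4 + ?K * (5 + Suc C * 13)"
      "\<And>i j. i \<le> ?K \<Longrightarrow> j \<le> C \<Longrightarrow> R i j = knapsack (weight I) (cost I) i j"
    using computes_step_iii[where a = a and w = "weight I" and C = C and I = I, OF i(3) refl]
    unfolding computes_def by auto
  have prefix: "{1..?K} \<inter> {k. k \<le> n} = {1..n}"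
    using ii(3) by auto
  \<comment> \<open>The indicator vector of the prefix chosen in step (ii) has cost exactly
    \<open>C\<close>, so the entry at \<open>C\<close> meets the demand and step (iv)
    applies.\<close>
  have "ereal (\<Sum>k\<in>{1..n}. weight I k) \<le> knapsack (weight I) (cost I) ?K C"
    using knapsack_ge[of ?K "\<lambda>k. of_bool (k \<le> n)" "weight I" "cost I"]
    using prefix by (simp add: ii(4))
  then have "ereal b \<le> knapsack (weight I) (cost I) ?K C"
    using ii(5) i(4) by (meson ereal_less_eq(3) order_trans)
  from computes_step_iv[where I = I and C = C and R = R, OF refl iii(4) this]
  obtain z t4 where iv: "step_iv I b R = Some (z, t4)" "t4 \<le> 8 + C * 4 + ?K * 13"
      "z \<in> {1..?K} \<rightarrow>\<^sub>E {0, 1}" "b \<le> (\<Sum>k\<in>{1..?K}. weight I k * real (z k))"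
      "\<forall>j<\<Sum>k\<in>{1..?K}. cost I k * z k. knapsack (weight I) (cost I) ?K j < ereal b"
    unfolding computes_def by auto
  have run: "algorithm1 I = Some (z, t1 + (t2 + (t3 + t4)))"
    by (simp add: algorithm1_def bind_timed_def i(1) ii(1) iii(1) iv(1))
  then have time: "running_time I = t1 + (t2 + (t3 + t4))"
    by (simp add: running_time_def)
  have cap: "capacity I = C"
    by (simp add: capacity_def bind_timed_def i(1) ii(1))
  show "\<exists>z. algorithm1 I = Some (z, running_time I) \<and>
      is_arg_min (objective I) (\<lambda>z. z \<in> feasible I) z"
    using run time iv i(4) is_arg_min_objective[OF I, of z] by (auto simp: objective_def)
  show "capacity I \<le> total_cost I"
    unfolding cap ii(4) total_cost_def using ii(3) by (intro sum_mono2) auto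
  show "?K * capacity I \<le> running_time I"
    using iii(2) by (simp add: time cap)
  \<comment> \<open>Writing \<open>K\<close> for \<open>num_items I\<close>, the four bounds add up
    to \<open>22 + 47 K + 8 C + 13 K C\<close>. Since \<open>1 \<le> K\<close>, this is at most
    \<open>69 K + 21 K C\<close>.\<close>
  have "1 \<le> ?K" using I by (auto simp: instances_def)
  then have "C \<le> ?K * C" by simp
  moreover have "t3 \<le> 5 + C * 4 + ?K * 18 + 13 * (?K * C)"
    using iii(3) by (simp add: algebra_simps)
  moreover have "100 * ?K * (C + 1) = 100 * (?K * C) + 100 * ?K"
    by (simp add: algebra_simps)
  ultimately show "running_time I \<le> 100 * ?K * (capacity I + 1)"
    unfolding time cap using \<open>1 \<le> ?K\<close> i(2) ii(2) iv(2) by linarith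
qed

section \<open>Cost estimates and asymptotic bounds\<close>

lemma max_cost_eq:
  assumes "I \<in> instances"
  shows "max_cost I = cost I (num_items I)"
proof -
  have "0 < num_items I" "mono_on {1..num_items I} (cost I)"
    using assms by (auto simp: instances_def)
  then show ?thesis
    unfolding max_cost_def by (intro Max_eqI) (auto intro: mono_onD)
qed

lemma total_cost_le: "total_cost I \<le> num_items I * max_cost I"
proof -
  have "total_cost I \<le> (\<Sum>k\<in>{1..num_items I}. max_cost I)"
    unfolding total_cost_def max_cost_def by (intro sum_mono) auto
  then show ?thesis by simp
qed

lemma total_cost_pos:
  assumes "I \<in> instances"
  shows "1 \<le> total_cost I"
proof -
  have "0 < num_items I" "\<And>k. k \<in> {1..num_items I} \<Longrightarrow> 0 < cost I k"
    using assms by (auto simp: instances_def)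
  then have "0 < total_cost I"
    unfolding total_cost_def by (intro sum_pos) auto
  then show ?thesis by simp
qed

text \<open>Along \<open>principal S\<close>, eventually means everywhere on \<open>S\<close>, so
  the O-statement is one constant uniform over all of \<open>S\<close>, without any limit.\<close>

lemma bigo_principal_nat:
  fixes f g :: "'a \<Rightarrow> nat"
  assumes "\<And>x. x \<in> S \<Longrightarrow> f x \<le> c * g x"
  shows "(\<lambda>x. real (f x)) \<in> O[principal S](\<lambda>x. real (g x))"
proof (rule bigoI[of _ "real c"])
  have "real (f x) \<le> real c * real (g x)" if "x \<in> S" for x
    using of_nat_mono[OF assms[OF that], where 'a = real] by simp
  then show "\<forall>\<^sub>F x in principal S. norm (real (f x)) \<le> real c * norm (real (g x))"
    by (simp add: eventually_principal)
qed

theorem mainTheorem4: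
  shows
    "(\<forall>I\<in>instances. \<exists>z t. algorithm1 I = Some (z, t) \<and>
        is_arg_min (objective I) (\<lambda>z. z \<in> feasible I) z) \<and>
     (\<forall>I\<in>instances. capacity I \<le> total_cost I \<and>
        total_cost I \<le> num_items I * max_cost I \<and>
        max_cost I = cost I (num_items I)) \<and>
     (\<lambda>I. real (running_time I))
        \<in> \<Theta>[principal {I \<in> instances. capacity I > 0}](\<lambda>I. real (num_items I * capacity I)) \<and>
     (\<lambda>I. real (running_time I))
        \<in> O[principal instances](\<lambda>I. real (num_items I * total_cost I)) \<and>
     (\<lambda>I. real (running_time I))
        \<in> O[principal instances](\<lambda>I. real ((num_items I)\<^sup>2 * max_cost I)) \<and>
     pseudo_polynomial_time running_time input_length max_number instances"
proof (intro conjI)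
  have time_total: "running_time I \<le> 200 * (num_items I * total_cost I)" if "I \<in> instances" for I
  proof -
    \<comment> \<open>The capacity may vanish, but the total cost is at least 1 and absorbs the
      extra 1.\<close>
    have "capacity I + 1 \<le> 2 * total_cost I"
      using algorithm1_spec(2)[OF that] total_cost_pos[OF that] by simp
    then have "100 * num_items I * (capacity I + 1) \<le> 100 * num_items I * (2 * total_cost I)"
      by (intro mult_left_mono) auto
    with algorithm1_spec(4)[OF that] show ?thesis by simp
  qed
  have time_max: "running_time I \<le> 200 * ((num_items I)\<^sup>2 * max_cost I)" if "I \<in> instances" for I
  proof -
    have "num_items I * total_cost I \<le> num_items I * (num_items I * max_cost I)"
      by (intro mult_left_mono total_cost_le) auto
    with time_total[OF that] have "running_time I \<le> 200 * (num_items I * (num_items I * max_cost I))"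
      by linarith
    then show ?thesis by (simp add: power2_eq_square mult.assoc)
  qed
  show "\<forall>I\<in>instances. \<exists>z t. algorithm1 I = Some (z, t) \<and>
      is_arg_min (objective I) (\<lambda>z. z \<in> feasible I) z"
    using algorithm1_spec(1) by blast
  show "\<forall>I\<in>instances. capacity I \<le> total_cost I \<and>
      total_cost I \<le> num_items I * max_cost I \<and> max_cost I = cost I (num_items I)"
    using algorithm1_spec(2) total_cost_le max_cost_eq by blast
  show "(\<lambda>I. real (running_time I))
      \<in> \<Theta>[principal {I \<in> instances. capacity I > 0}](\<lambda>I. real (num_items I * capacity I))"
  proof (rule bigthetaI)
    have "running_time I \<le> 200 * (num_items I * capacity I)"
      if "I \<in> instances" "capacity I > 0" for I
    proof -
      \<comment> \<open>Here positivity of the capacity absorbs the extra 1; this is why the Theta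
        claim is restricted to such instances.\<close>
      have "100 * num_items I * (capacity I + 1) \<le> 100 * num_items I * (2 * capacity I)"
        using that(2) by (intro mult_left_mono) auto
      with algorithm1_spec(4)[OF that(1)] have "running_time I \<le> 100 * num_items I * (2 * capacity I)"
        by (rule order_trans)
      then show ?thesis by simp
    qed
    then show "(\<lambda>I. real (running_time I))
        \<in> O[principal {I \<in> instances. capacity I > 0}](\<lambda>I. real (num_items I * capacity I))"
      by (intro bigo_principal_nat) auto
    show "(\<lambda>I. real (running_time I))
        \<in> \<Omega>[principal {I \<in> instances. capacity I > 0}](\<lambda>I. real (num_items I * capacity I))"
      unfolding bigomega_iff_bigo
      using algorithm1_spec(3) by (intro bigo_principal_nat[where c = 1]) auto
  qed
  show "(\<lambda>I. real (running_time I)) \<in> O[principal instances](\<lambda>I. real (num_items I * total_cost I))"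
    using time_total by (rule bigo_principal_nat)
  show "(\<lambda>I. real (running_time I))
      \<in> O[principal instances](\<lambda>I. real ((num_items I)\<^sup>2 * max_cost I))"
    using time_max by (rule bigo_principal_nat)
  show "pseudo_polynomial_time running_time input_length max_number instances"
    unfolding pseudo_polynomial_time_def
  proof (intro exI ballI)
    fix I assume I: "I \<in> instances"
    \<comment> \<open>The cells for the real inputs alone make the input longer than the number of
      items.\<close>
    have "(num_items I)\<^sup>2 * max_cost I \<le> (input_length I)\<^sup>2 * max_number I"
      by (intro mult_mono power_mono) (auto simp: input_length_def max_number_def)
    with time_max[OF I] have "running_time I \<le> 200 * ((input_length I)\<^sup>2 * max_number I)"
      by linarith
    \<comment> \<open>The witness is \<open>200 x^2 y\<close>: the inner variable \<open>x\<close>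
      is the input length, the outer variable \<open>y\<close> the largest number.\<close>
    then show "running_time I \<le> poly (poly (monom (monom 200 2) 1) [:max_number I:]) (input_length I)"
      by (simp add: poly_monom mult.commute mult.left_commute)
  qed
qed

end
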